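(* Assume $\mathcal{D}\cap\mathcal{T}=\emptyset$, $\mathcal{D}\cap\mathcal{B}=\emptyset$ and $\mathcal{T}\cap\mathcal{C}=\emptyset$, and let $p=|\mathcal{C}|$. Consider the $(C,A)$-invariant set of nodes $\mathcal{S}=\mathcal{S}^\circ(\mathcal{C})$, with basis matrix $S$. If $\mathcal{C}$ is a set of output nodes such that $\mathcal{C}=\partial_-(\mathcal{S}^\circ(\mathcal{C}),A)$, then $H=AC^\top+H_q$ is the unique friend of $\mathcal{S}^\circ(\mathcal{C})$, up to $H_q=SN$ with $N$ a generic $|\mathcal{S}|\times p$ matrix of coefficients (that is, the friends of $\mathcal{S}^\circ(\mathcal{C})$ are exactly the matrices $AC^\top+SN$ with $N\in\mathbb{R}^{|\mathcal{S}|\times p}$ arbitrary).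
   Context: Let $(\mathcal{V},\mathcal{E},A)$ be a digraph with $\mathcal{V}=\{v_1,\dots,v_n\}$, where $(v_i,v_j)\in\mathcal{E}$ means $v_i\to v_j$, and $A\in\mathbb{R}^{n\times n}$ has $A_{ji}\ne0$ if and only if $(v_i,v_j)\in\mathcal{E}$. $\mathcal{B},\mathcal{C},\mathcal{D},\mathcal{T}\subseteq\mathcal{V}$ are the sets of input, output, disturbance and target nodes; the rows of $C\in\mathbb{R}^{p\times n}$ are the $e_i^\top$ with $v_i\in\mathcal{C}$. A node set is identified with the subspace of $\mathbb{R}^n$ spanned by the corresponding canonical vectors; the basis matrix of a node set $\mathcal{S}$ has as columns the $e_i$ with $v_i\in\mathcal{S}$. $\mathcal{S}$ is $(C,A)$-invariant if $A(\mathcal{S}\setminus\mathcal{C})\subseteq\mathcal{S}$. A friend of $\mathcal{S}$ is a matrix $H\in\mathbb{R}^{n\times p}$ with $(A-HC)\mathcal{S}\subseteq\mathcal{S}$. $\mathcal{S}^\circ(\mathcal{C})$ is the (stationary) limit of $\mathcal{S}_0=\mathcal{D}$, $\mathcal{S}_{k+1}=\mathcal{S}_k\cup\{v_j\notin\mathcal{S}_k:\exists\,(v_i,v_j)\in\mathcal{E}\text{ with }v_i\in\mathcal{S}_k\setminus\mathcal{C}\}$, i.e. the minimal $(C,A)$-invariant set of nodes containing $\mathcal{D}$. In-boundary: $\partial_-(\mathcal{W},A)=\{v_i\in\mathcal{W}:\exists\,(v_i,v_j)\in\mathcal{E},\ v_j\in\mathcal{V}\setminus\mathcal{W}\}$.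 *)

theory Defs
  imports "Jordan_Normal_Form.VS_Connect"
begin

text \<open>The nodes \<open>v\<^sub>1, \<dots>, v\<^sub>n\<close> are the indices in \<open>{..<n}\<close>, and \<open>(i, j) \<in> E\<close> is the edge \<open>i \<rightarrow> j\<close>.
  Vectors and matrices have explicit carriers, so that the dimensions \<open>n = 0\<close>, \<open>card C = 0\<close> and
  \<open>card S = 0\<close> are included.\<close>

definition node_space :: "nat \<Rightarrow> nat set \<Rightarrow> real vec set" where
  "node_space n S = LinearCombinations.module.span class_ring (module_vec TYPE(real) n) (unit_vec n ` S)"

text \<open>For a finite node set the columns (rows) are listed by increasing index.\<close>

definition basis_mat :: "nat \<Rightarrow> nat set \<Rightarrow> real mat" where
  "basis_mat n S = mat_of_cols n (map (unit_vec n) (sorted_list_of_set S))"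

definition output_mat :: "nat \<Rightarrow> nat set \<Rightarrow> real mat" where
  "output_mat n C = mat_of_rows n (map (unit_vec n) (sorted_list_of_set C))"

definition CA_invariant :: "nat \<Rightarrow> nat set \<Rightarrow> real mat \<Rightarrow> nat set \<Rightarrow> bool" where
  "CA_invariant n C A S \<longleftrightarrow> (\<lambda>x. A *\<^sub>v x) ` node_space n (S - C) \<subseteq> node_space n S"

definition friend :: "nat \<Rightarrow> nat set \<Rightarrow> real mat \<Rightarrow> nat set \<Rightarrow> real mat \<Rightarrow> bool" where
  "friend n C A S H \<longleftrightarrow> H \<in> carrier_mat n (card C) \<and>
     (\<lambda>x. (A - H * output_mat n C) *\<^sub>v x) ` node_space n S \<subseteq> node_space n S"

definition in_boundary :: "nat \<Rightarrow> (nat \<times> nat) set \<Rightarrow> nat set \<Rightarrow> nat set" where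
  "in_boundary n E W = {i \<in> W. \<exists>j \<in> {..<n} - W. (i, j) \<in> E}"

primrec inv_step :: "(nat \<times> nat) set \<Rightarrow> nat set \<Rightarrow> nat set \<Rightarrow> nat \<Rightarrow> nat set" where
  "inv_step E D C 0 = D"
| "inv_step E D C (Suc k) = inv_step E D C k \<union>
     {j. j \<notin> inv_step E D C k \<and> (\<exists>i \<in> inv_step E D C k - C. (i, j) \<in> E)}"

text \<open>The limit of the increasing sequence. It is attained after finitely many steps
  (\<open>inv_step_stationary\<close>) and is the least invariant set of nodes containing \<open>D\<close>
  (\<open>min_inv_least\<close>).\<close>

definition min_inv :: "(nat \<times> nat) set \<Rightarrow> nat set \<Rightarrow> nat set \<Rightarrow> nat set" where
  "min_inv E D C = (\<Union>k. inv_step E D C k)"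

lemma inv_step_mono: "k \<le> l \<Longrightarrow> inv_step E D C k \<subseteq> inv_step E D C l"
  by (rule lift_Suc_mono_le[of "inv_step E D C"]) auto

lemma inv_step_subset:
  assumes "D \<subseteq> {..<n}" "E \<subseteq> {..<n} \<times> {..<n}"
  shows "inv_step E D C k \<subseteq> {..<n}"
  using assms by (induction k) auto

lemma min_inv_subset:
  assumes "D \<subseteq> {..<n}" "E \<subseteq> {..<n} \<times> {..<n}"
  shows "min_inv E D C \<subseteq> {..<n}"
  using inv_step_subset[OF assms] by (auto simp: min_inv_def)

lemma inv_step_stationary:
  assumes "D \<subseteq> {..<n}" "E \<subseteq> {..<n} \<times> {..<n}"
  shows "\<exists>K. \<forall>k\<ge>K. inv_step E D C k = min_inv E D C"
proof -
  have fin: "finite (min_inv E D C)"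
    using min_inv_subset[OF assms] finite_subset by blast
  have "\<forall>x \<in> min_inv E D C. \<exists>k. x \<in> inv_step E D C k"
    by (auto simp: min_inv_def)
  then obtain f where f: "\<And>x. x \<in> min_inv E D C \<Longrightarrow> x \<in> inv_step E D C (f x)"
    by metis
  have "inv_step E D C k = min_inv E D C" if k: "k \<ge> Max (f ` min_inv E D C)" for k
  proof
    show "inv_step E D C k \<subseteq> min_inv E D C" by (auto simp: min_inv_def)
    show "min_inv E D C \<subseteq> inv_step E D C k"
    proof
      fix x assume x: "x \<in> min_inv E D C"
      have "f x \<le> Max (f ` min_inv E D C)" using fin x by (intro Max_ge) auto
      then have "f x \<le> k" using k by linarith
      then show "x \<in> inv_step E D C k" using f[OF x] inv_step_mono by blast
    qed
  qed
  then show ?thesis by blast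
qed

lemma node_space_iff:
  assumes "S \<subseteq> {..<n}"
  shows "v \<in> node_space n S \<longleftrightarrow> v \<in> carrier_vec n \<and> (\<forall>i<n. i \<notin> S \<longrightarrow> v $ i = 0)"
proof -
  interpret vec_space "TYPE(real)" n .
  have U: "unit_vec n ` S \<subseteq> (carrier_vec n :: real vec set)" by auto
  have ns: "node_space n S = span (unit_vec n ` S)" by (simp add: node_space_def)
  have fin: "finite S" using assms finite_subset by blast
  show ?thesis
  proof
    assume "v \<in> node_space n S"
    then obtain a B where B: "v = lincomb a B" "finite B" "B \<subseteq> unit_vec n ` S"
      unfolding ns using in_spanE by metis
    have Bc: "B \<subseteq> carrier_vec n" using B U by blast
    have "v $ i = 0" if i: "i < n" "i \<notin> S" for i
    proof -
      have "v $ i = (\<Sum>x\<in>B. a x * x $ i)"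
        unfolding B(1) using lincomb_index[OF i(1) Bc] .
      also have "\<dots> = 0"
      proof (intro sum.neutral ballI)
        fix x assume "x \<in> B"
        then obtain j where "j \<in> S" "x = unit_vec n j" using B(3) by blast
        then show "a x * x $ i = 0" using i assms by (auto simp: unit_vec_def)
      qed
      finally show ?thesis .
    qed
    then show "v \<in> carrier_vec n \<and> (\<forall>i<n. i \<notin> S \<longrightarrow> v $ i = 0)"
      using B(1,2) Bc lincomb_dim by auto
  next
    assume v: "v \<in> carrier_vec n \<and> (\<forall>i<n. i \<notin> S \<longrightarrow> v $ i = 0)"
    define a where "a u = v $ (THE i. i < n \<and> u = unit_vec n i)" for u :: "real vec"
    have uinj: "unit_vec n i = (unit_vec n j :: real vec) \<longleftrightarrow> i = j" if "i < n" "j < n" for i j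
      using that by (metis index_unit_vec(1) zero_neq_one)
    have a: "a (unit_vec n i) = v $ i" if "i < n" for i
    proof -
      have "(THE j. j < n \<and> unit_vec n i = (unit_vec n j :: real vec)) = i"
        using that uinj by (intro the_equality) auto
      then show ?thesis by (simp add: a_def)
    qed
    have inj: "inj_on (unit_vec n :: nat \<Rightarrow> real vec) S"
      using assms uinj by (auto simp: inj_on_def)
    have "lincomb a (unit_vec n ` S) = v"
    proof (rule eq_vecI)
      show "dim_vec (lincomb a (unit_vec n ` S)) = dim_vec v"
        using lincomb_dim[OF _ U] fin v by auto
      fix i assume "i < dim_vec v"
      then have i: "i < n" using v by auto
      have "lincomb a (unit_vec n ` S) $ i = (\<Sum>x\<in>unit_vec n ` S. a x * x $ i)"
        using lincomb_index[OF i U] .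
      also have "\<dots> = (\<Sum>j\<in>S. v $ j * (if i = j then 1 else 0))"
        unfolding sum.reindex[OF inj] using assms i a
        by (intro sum.cong) (auto simp: unit_vec_def)
      also have "\<dots> = v $ i" using fin v i by (auto simp: if_distrib cong: if_cong)
      finally show "lincomb a (unit_vec n ` S) $ i = v $ i" .
    qed
    then show "v \<in> node_space n S" unfolding ns using fin in_spanI by (metis finite_imageI subset_refl)
  qed
qed

lemma CA_invariant_iff:
  assumes A: "A \<in> carrier_mat n n" and E: "E \<subseteq> {..<n} \<times> {..<n}"
    and AE: "\<And>i j. i < n \<Longrightarrow> j < n \<Longrightarrow> A $$ (j, i) \<noteq> 0 \<longleftrightarrow> (i, j) \<in> E"
    and S: "S \<subseteq> {..<n}"
  shows "CA_invariant n C A S \<longleftrightarrow> (\<forall>i j. (i, j) \<in> E \<longrightarrow> i \<in> S - C \<longrightarrow> j \<in> S)"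
proof
  assume inv: "CA_invariant n C A S"
  show "\<forall>i j. (i, j) \<in> E \<longrightarrow> i \<in> S - C \<longrightarrow> j \<in> S"
  proof (intro allI impI, rule ccontr)
    fix i j assume ij: "(i, j) \<in> E" "i \<in> S - C" "j \<notin> S"
    have i: "i < n" and j: "j < n" using ij(1) E by auto
    have "unit_vec n i \<in> node_space n (S - C)"
      using S ij i by (subst node_space_iff) (auto simp: unit_vec_def)
    then have "A *\<^sub>v unit_vec n i \<in> node_space n S"
      using inv by (auto simp: CA_invariant_def)
    then have "(A *\<^sub>v unit_vec n i) $ j = 0"
      using ij(3) j node_space_iff[OF S] by blast
    then have "A $$ (j, i) = 0" using A i j by auto
    then show False using AE[OF i j] ij(1) by blast
  qed
next
  assume cl: "\<forall>i j. (i, j) \<in> E \<longrightarrow> i \<in> S - C \<longrightarrow> j \<in> S"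
  have SC: "S - C \<subseteq> {..<n}" using S by blast
  have "A *\<^sub>v x \<in> node_space n S" if x: "x \<in> node_space n (S - C)" for x
  proof -
    have xc: "x \<in> carrier_vec n" and x0: "\<And>i. i < n \<Longrightarrow> i \<notin> S - C \<Longrightarrow> x $ i = 0"
      using x node_space_iff[OF SC] by blast+
    have "(A *\<^sub>v x) $ j = 0" if j: "j < n" "j \<notin> S" for j
    proof -
      have "(A *\<^sub>v x) $ j = (\<Sum>i = 0..<n. A $$ (j, i) * x $ i)"
        using A xc j by (auto simp: scalar_prod_def)
      also have "\<dots> = 0"
      proof (intro sum.neutral ballI)
        fix i assume "i \<in> {0..<n}"
        then have i: "i < n" by simp
        show "A $$ (j, i) * x $ i = 0"
          using cl x0[OF i] AE[OF i j(1)] j(2) by (cases "i \<in> S - C") auto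
      qed
      finally show ?thesis .
    qed
    then show ?thesis using A xc node_space_iff[OF S] by auto
  qed
  then show "CA_invariant n C A S" by (auto simp: CA_invariant_def)
qed

lemma min_inv_least:
  assumes A: "A \<in> carrier_mat n n" and E: "E \<subseteq> {..<n} \<times> {..<n}"
    and AE: "\<And>i j. i < n \<Longrightarrow> j < n \<Longrightarrow> A $$ (j, i) \<noteq> 0 \<longleftrightarrow> (i, j) \<in> E"
    and D: "D \<subseteq> {..<n}"
  shows "D \<subseteq> min_inv E D C" and "CA_invariant n C A (min_inv E D C)"
    and "\<And>S. S \<subseteq> {..<n} \<Longrightarrow> D \<subseteq> S \<Longrightarrow> CA_invariant n C A S \<Longrightarrow> min_inv E D C \<subseteq> S"
proof -
  have "inv_step E D C 0 \<subseteq> min_inv E D C" unfolding min_inv_def by blast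
  then show "D \<subseteq> min_inv E D C" by simp
  have "j \<in> min_inv E D C" if ij: "(i, j) \<in> E" "i \<in> min_inv E D C - C" for i j
  proof -
    obtain k where "i \<in> inv_step E D C k" using ij by (auto simp: min_inv_def)
    then have "j \<in> inv_step E D C (Suc k)" using ij by auto
    then show ?thesis unfolding min_inv_def by blast
  qed
  then show "CA_invariant n C A (min_inv E D C)"
    using CA_invariant_iff[OF A E AE min_inv_subset[OF D E]] by blast
  fix S assume S: "S \<subseteq> {..<n}" "D \<subseteq> S" "CA_invariant n C A S"
  then have cl: "\<And>i j. (i, j) \<in> E \<Longrightarrow> i \<in> S - C \<Longrightarrow> j \<in> S"
    using CA_invariant_iff[OF A E AE S(1)] by blast
  have "inv_step E D C k \<subseteq> S" for k using S(2) cl by (induction k) auto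
  then show "min_inv E D C \<subseteq> S" by (auto simp: min_inv_def)
qed

end

theory Submission
  imports Defs
begin

text \<open>Write \<open>B\<close> for the basis matrix of the output set, so that the output matrix is \<open>B\<^sup>T\<close>. Its
  columns are orthonormal: \<open>B\<^sup>T B\<close> is the identity, while \<open>B B\<^sup>T\<close> is the projection that keeps
  exactly the output coordinates. The output set, being a boundary of \<open>\<S>\<close>, is
  contained in \<open>\<S>\<close>, and \<open>\<S>\<close> is invariant as the limit of its defining sequence.

  Given these two properties, \<open>H\<close> is a friend exactly if every column of \<open>H - A B\<close> lies in the
  subspace of \<open>\<S>\<close> (\<open>friend_iff_cols_in_node_space\<close>). Indeed, for \<open>x\<close> in this subspace,
  \<open>(A - H B\<^sup>T) x = A (x - B B\<^sup>T x) - (H - A B) (B\<^sup>T x)\<close>. The vector \<open>x - B B\<^sup>T x\<close> is supported on the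
  nodes of \<open>\<S>\<close> that are not outputs, so invariance puts the first term into the subspace and
  only the second term imposes a condition; since the output nodes belong to \<open>\<S>\<close>, the vector
  \<open>B\<^sup>T x\<close> takes every value, and so this condition concerns all columns of \<open>H - A B\<close>. Finally,
  the matrices whose columns lie in the subspace are the products \<open>S N\<close>
  (\<open>cols_in_node_space_iff\<close>).\<close>

section \<open>Basis matrices and coordinate projections\<close>

lemma basis_mat_carrier: "basis_mat n S \<in> carrier_mat n (card S)"
  using mat_of_cols_carrier(1)[of n "map (unit_vec n) (sorted_list_of_set S)"]
  by (simp add: basis_mat_def)

lemma output_mat_eq_transpose: "output_mat n S = transpose_mat (basis_mat n S)"
proof -
  have "set (map (unit_vec n) (sorted_list_of_set S)) \<subseteq> carrier_vec n" by auto
  then show ?thesis by (simp add: output_mat_def basis_mat_def transpose_mat_of_cols)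
qed

lemma col_basis_mat:
  assumes "k < card S"
  shows "col (basis_mat n S) k = unit_vec n (sorted_list_of_set S ! k)"
  unfolding basis_mat_def using assms by (subst col_mat_of_cols) simp_all

lemma mat_diff_eq_iff:
  fixes M P Q :: "'a :: ab_group_add mat"
  assumes "M \<in> carrier_mat m p" "P \<in> carrier_mat m p" "Q \<in> carrier_mat m p"
  shows "M - P = Q \<longleftrightarrow> M = P + Q"
  using assms by (auto simp: mat_eq_iff algebra_simps)

lemma sorted_list_of_set_nth:
  fixes S :: "nat set"
  assumes "S \<subseteq> {..<n}" "k < card S"
  shows "sorted_list_of_set S ! k \<in> S" "sorted_list_of_set S ! k < n"
proof -
  have "finite S" using finite_subset[OF assms(1) finite_lessThan] .
  then show "sorted_list_of_set S ! k \<in> S"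
    using assms(2) nth_mem[of k "sorted_list_of_set S"] by simp
  then show "sorted_list_of_set S ! k < n" using assms(1) by blast
qed

lemma basis_mat_orthonormal:
  assumes S: "S \<subseteq> {..<n}"
  shows "transpose_mat (basis_mat n S) * basis_mat n S = 1\<^sub>m (card S)"
proof (rule eq_matI)
  have fin: "finite S" using finite_subset[OF S finite_lessThan] .
  fix k l assume "k < dim_row (1\<^sub>m (card S))" "l < dim_col (1\<^sub>m (card S))"
  then have k: "k < card S" and l: "l < card S" by auto
  have "(transpose_mat (basis_mat n S) * basis_mat n S) $$ (k, l) =
      col (basis_mat n S) k \<bullet> col (basis_mat n S) l"
    using k l basis_mat_carrier by (metis carrier_matD(2) index_mult_mat(1) index_transpose_mat(2) row_transpose)
  also have "\<dots> = (if k = l then 1 else 0)"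
    using k l fin sorted_list_of_set_nth[OF S k] sorted_list_of_set_nth[OF S l]
    by (simp add: col_basis_mat nth_eq_iff_index_eq)
  finally show "(transpose_mat (basis_mat n S) * basis_mat n S) $$ (k, l) = 1\<^sub>m (card S) $$ (k, l)"
    using k l by simp
qed (use basis_mat_carrier[of n S] in auto)

lemma basis_mat_projection:
  assumes S: "S \<subseteq> {..<n}" and x: "x \<in> carrier_vec n" and i: "i < n"
  shows "(basis_mat n S *\<^sub>v (transpose_mat (basis_mat n S) *\<^sub>v x)) $ i = (if i \<in> S then x $ i else 0)"
proof -
  let ?l = "sorted_list_of_set S" and ?B = "basis_mat n S"
  have fin: "finite S" using finite_subset[OF S finite_lessThan] .
  have B: "?B \<in> carrier_mat n (card S)" by (rule basis_mat_carrier)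
  have bij: "bij_betw (\<lambda>k. ?l ! k) {0..<card S} S"
    using fin by (intro bij_betw_nth) (auto simp: atLeast0LessThan)
  have coord: "(transpose_mat ?B *\<^sub>v x) $ k = x $ (?l ! k)" if "k < card S" for k
    using that B x sorted_list_of_set_nth[OF S that] by (simp add: col_basis_mat)
  have entry: "?B $$ (i, k) = (if i = ?l ! k then 1 else 0)" if k: "k < card S" for k
  proof -
    have "?B $$ (i, k) = col ?B k $ i" using B i k by auto
    then show ?thesis using i sorted_list_of_set_nth[OF S k] by (simp add: col_basis_mat[OF k])
  qed
  have "(?B *\<^sub>v (transpose_mat ?B *\<^sub>v x)) $ i =
      (\<Sum>k = 0..<card S. ?B $$ (i, k) * (transpose_mat ?B *\<^sub>v x) $ k)"
    using B i by (auto simp: scalar_prod_def intro!: sum.cong)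
  also have "\<dots> = (\<Sum>k = 0..<card S. (if i = ?l ! k then 1 else 0) * x $ (?l ! k))"
    using coord entry by (intro sum.cong) auto
  also have "\<dots> = (\<Sum>j\<in>S. (if i = j then 1 else 0) * x $ j)"
    using sum.reindex_bij_betw[OF bij, of "\<lambda>j. (if i = j then 1 else 0) * x $ j"] .
  also have "\<dots> = (if i \<in> S then x $ i else 0)"
    using fin by (auto simp: if_distrib[of "\<lambda>c. c * _"] cong: if_cong)
  finally show ?thesis .
qed

lemma basis_mat_mult_in_node_space:
  assumes S: "S \<subseteq> {..<n}" and y: "y \<in> carrier_vec (card S)"
  shows "basis_mat n S *\<^sub>v y \<in> node_space n S"
proof -
  let ?B = "basis_mat n S"
  have B: "?B \<in> carrier_mat n (card S)" by (rule basis_mat_carrier)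
  \<comment> \<open>Orthonormality makes \<open>B y\<close> a fixed point of the projection, which has no entries outside
    the node set.\<close>
  have "transpose_mat ?B *\<^sub>v (?B *\<^sub>v y) = (transpose_mat ?B * ?B) *\<^sub>v y"
    using B y by (intro assoc_mult_mat_vec[symmetric]) auto
  then have "transpose_mat ?B *\<^sub>v (?B *\<^sub>v y) = y"
    using basis_mat_orthonormal[OF S] y by simp
  then have "(?B *\<^sub>v y) $ i = (if i \<in> S then (?B *\<^sub>v y) $ i else 0)" if "i < n" for i
    using basis_mat_projection[OF S _ that, of "?B *\<^sub>v y"] B y by simp
  then show ?thesis using B y node_space_iff[OF S] by (metis mult_mat_vec_carrier)
qed

lemma node_space_projection:
  assumes S: "S \<subseteq> {..<n}" and x: "x \<in> node_space n S"
  shows "basis_mat n S *\<^sub>v (transpose_mat (basis_mat n S) *\<^sub>v x) = x"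
proof (rule eq_vecI)
  have xc: "x \<in> carrier_vec n" and x0: "\<And>i. i < n \<Longrightarrow> i \<notin> S \<Longrightarrow> x $ i = 0"
    using x node_space_iff[OF S] by blast+
  show "dim_vec (basis_mat n S *\<^sub>v (transpose_mat (basis_mat n S) *\<^sub>v x)) = dim_vec x"
    using xc basis_mat_carrier[of n S] by simp
  fix i assume "i < dim_vec x"
  then show "(basis_mat n S *\<^sub>v (transpose_mat (basis_mat n S) *\<^sub>v x)) $ i = x $ i"
    using basis_mat_projection[OF S xc] x0 xc by auto
qed

section \<open>Matrices with columns in a node space\<close>

text \<open>The coefficients are recovered as \<open>N = S\<^sup>T M\<close>, because \<open>S S\<^sup>T\<close> fixes every vector of the
  subspace.\<close>

lemma cols_in_node_space_iff:
  assumes S: "S \<subseteq> {..<n}" and M: "M \<in> carrier_mat n p"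
  shows "(\<forall>k<p. col M k \<in> node_space n S) \<longleftrightarrow>
    (\<exists>N \<in> carrier_mat (card S) p. M = basis_mat n S * N)"
proof
  let ?B = "basis_mat n S"
  have B: "?B \<in> carrier_mat n (card S)" by (rule basis_mat_carrier)
  assume cols: "\<forall>k<p. col M k \<in> node_space n S"
  have N: "transpose_mat ?B * M \<in> carrier_mat (card S) p" using B M by simp
  have "M = ?B * (transpose_mat ?B * M)"
  proof (rule mat_col_eqI)
    fix k assume "k < dim_col (?B * (transpose_mat ?B * M))"
    then have k: "k < p" using M by simp
    have "col (?B * (transpose_mat ?B * M)) k = ?B *\<^sub>v (transpose_mat ?B *\<^sub>v col M k)"
      using col_mult2[OF B N k] col_mult2[OF _ M k, of "transpose_mat ?B" "card S"] B by simp
    then show "col M k = col (?B * (transpose_mat ?B * M)) k"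
      using node_space_projection[OF S] cols k by simp
  qed (use B M in auto)
  then show "\<exists>N \<in> carrier_mat (card S) p. M = ?B * N" using N by blast
next
  assume "\<exists>N \<in> carrier_mat (card S) p. M = basis_mat n S * N"
  then obtain N where N: "N \<in> carrier_mat (card S) p" "M = basis_mat n S * N" by blast
  show "\<forall>k<p. col M k \<in> node_space n S"
  proof (intro allI impI)
    fix k assume k: "k < p"
    have "col M k = basis_mat n S *\<^sub>v col N k"
      using col_mult2[OF basis_mat_carrier N(1) k] N(2) by simp
    then show "col M k \<in> node_space n S"
      using basis_mat_mult_in_node_space[OF S] N(1) k by simp
  qed
qed

lemma node_space_diff:
  assumes S: "S \<subseteq> {..<n}" and "x \<in> node_space n S" "y \<in> node_space n S"
  shows "x - y \<in> node_space n S"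
  using assms(2,3) by (auto simp: node_space_iff[OF S])

lemma node_space_mono:
  assumes "S \<subseteq> {..<n}" "T \<subseteq> S"
  shows "node_space n T \<subseteq> node_space n S"
  using assms node_space_iff[of S n] node_space_iff[of T n] by blast

text \<open>Since \<open>M = S N\<close>, the vector \<open>M y = S (N y)\<close> is again a combination of the columns of \<open>S\<close>.\<close>

lemma mult_in_node_space_of_cols:
  assumes S: "S \<subseteq> {..<n}" and M: "M \<in> carrier_mat n p"
    and cols: "\<forall>k<p. col M k \<in> node_space n S" and y: "y \<in> carrier_vec p"
  shows "M *\<^sub>v y \<in> node_space n S"
proof -
  obtain N where N: "N \<in> carrier_mat (card S) p" "M = basis_mat n S * N"
    using cols cols_in_node_space_iff[OF S M] by blast
  then have "M *\<^sub>v y = basis_mat n S *\<^sub>v (N *\<^sub>v y)"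
    using assoc_mult_mat_vec[OF basis_mat_carrier N(1) y] by simp
  moreover have "N *\<^sub>v y \<in> carrier_vec (card S)" using N(1) y by simp
  ultimately show ?thesis using basis_mat_mult_in_node_space[OF S] by simp
qed

section \<open>Friends of an invariant set of nodes\<close>

text \<open>On the nodes of \<open>S\<close> that are not outputs the matrix \<open>H\<close> has no effect and invariance does
  the work; on the \<open>k\<close>-th output node, \<open>A - H C\<close> acts as the \<open>k\<close>-th column of \<open>A C\<^sup>T - H\<close>, which is
  therefore forced into the subspace.\<close>

lemma friend_iff_cols_in_node_space:
  assumes A: "A \<in> carrier_mat n n" and S: "S \<subseteq> {..<n}" and CS: "C \<subseteq> S"
    and inv: "CA_invariant n C A S" and H: "H \<in> carrier_mat n (card C)"
  shows "friend n C A S H \<longleftrightarrow> (\<forall>k<card C. col (H - A * basis_mat n C) k \<in> node_space n S)"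
proof -
  let ?B = "basis_mat n C"
  let ?M = "H - A * ?B"
  have Cn: "C \<subseteq> {..<n}" using CS S by blast
  have B: "?B \<in> carrier_mat n (card C)" by (rule basis_mat_carrier)
  have M: "?M \<in> carrier_mat n (card C)"
    by (rule minus_carrier_mat[OF mult_carrier_mat[OF A B]])
  have split: "(A - H * output_mat n C) *\<^sub>v x =
      A *\<^sub>v (x - ?B *\<^sub>v (transpose_mat ?B *\<^sub>v x)) - ?M *\<^sub>v (transpose_mat ?B *\<^sub>v x)"
    if x: "x \<in> carrier_vec n" for x
  proof -
    define y where "y = transpose_mat ?B *\<^sub>v x"
    have y: "y \<in> carrier_vec (card C)" using B x by (simp add: y_def)
    have lhs: "(A - H * output_mat n C) *\<^sub>v x = A *\<^sub>v x - H *\<^sub>v y"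
      using A H B x y_def
      by (simp add: output_mat_eq_transpose minus_mult_distrib_mat_vec[of _ n n]
          assoc_mult_mat_vec[of _ n "card C" _ n])
    have minuend: "A *\<^sub>v (x - ?B *\<^sub>v y) = A *\<^sub>v x - A *\<^sub>v (?B *\<^sub>v y)"
      using A B x y by (intro mult_minus_distrib_mat_vec) auto
    have subtrahend: "?M *\<^sub>v y = H *\<^sub>v y - A *\<^sub>v (?B *\<^sub>v y)"
      using A B H y
      by (simp add: minus_mult_distrib_mat_vec[of _ n "card C"] assoc_mult_mat_vec[of _ n n _ "card C"])
    have cancel: "u - w = (u - v) - (w - v)"
      if "u \<in> carrier_vec n" "v \<in> carrier_vec n" "w \<in> carrier_vec n" for u v w :: "real vec"
      using that by (intro eq_vecI) auto
    show ?thesis unfolding y_def[symmetric] lhs minuend subtrahend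
      by (rule cancel) (use A B H x y in auto)
  qed
  have rest: "A *\<^sub>v (x - ?B *\<^sub>v (transpose_mat ?B *\<^sub>v x)) \<in> node_space n S"
    if x: "x \<in> node_space n S" for x
  proof -
    have xc: "x \<in> carrier_vec n" and x0: "\<And>i. i < n \<Longrightarrow> i \<notin> S \<Longrightarrow> x $ i = 0"
      using x node_space_iff[OF S] by blast+
    have SC: "S - C \<subseteq> {..<n}" using S by blast
    have Px: "?B *\<^sub>v (transpose_mat ?B *\<^sub>v x) \<in> carrier_vec n" using B xc by simp
    have "(x - ?B *\<^sub>v (transpose_mat ?B *\<^sub>v x)) $ i = 0" if i: "i < n" "i \<notin> S - C" for i
    proof -
      have "(x - ?B *\<^sub>v (transpose_mat ?B *\<^sub>v x)) $ i = x $ i - (if i \<in> C then x $ i else 0)"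
        using index_minus_vec(1)[of i "?B *\<^sub>v (transpose_mat ?B *\<^sub>v x)" x] carrier_vecD[OF Px] i(1)
        unfolding basis_mat_projection[OF Cn xc i(1)] by argo
      then show ?thesis using i x0[OF i(1)] by auto
    qed
    then have "x - ?B *\<^sub>v (transpose_mat ?B *\<^sub>v x) \<in> node_space n (S - C)"
      unfolding node_space_iff[OF SC] using minus_carrier_vec[OF xc Px] by blast
    then show ?thesis using inv by (auto simp: CA_invariant_def)
  qed
  show ?thesis
  proof
    assume fr: "friend n C A S H"
    show "\<forall>k<card C. col ?M k \<in> node_space n S"
    proof (intro allI impI)
      fix k assume k: "k < card C"
      \<comment> \<open>The \<open>k\<close>-th output node as a vector: its output is the \<open>k\<close>-th unit vector, which picks
        out the column, and the projection leaves nothing of it over.\<close>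
      let ?x = "?B *\<^sub>v unit_vec (card C) k"
      have "?x \<in> node_space n C" by (rule basis_mat_mult_in_node_space[OF Cn]) simp
      then have x: "?x \<in> node_space n S" using node_space_mono[OF S CS] by blast
      then have xc: "?x \<in> carrier_vec n" using node_space_iff[OF S] by blast
      have "transpose_mat ?B *\<^sub>v ?x = (transpose_mat ?B * ?B) *\<^sub>v unit_vec (card C) k"
        using B by (intro assoc_mult_mat_vec[symmetric]) auto
      then have out: "transpose_mat ?B *\<^sub>v ?x = unit_vec (card C) k"
        using basis_mat_orthonormal[OF Cn] by simp
      have "?M *\<^sub>v unit_vec (card C) k = col ?M k"
        using M k by (intro eq_vecI) auto
      moreover have "?M *\<^sub>v unit_vec (card C) k =
          A *\<^sub>v (?x - ?B *\<^sub>v (transpose_mat ?B *\<^sub>v ?x)) - (A - H * output_mat n C) *\<^sub>v ?x"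
      proof -
        have "A *\<^sub>v (?x - ?x) \<in> carrier_vec n" "?M *\<^sub>v unit_vec (card C) k \<in> carrier_vec n"
          using A M xc by auto
        then show ?thesis unfolding split[OF xc] out by (intro eq_vecI) auto
      qed
      moreover have "(A - H * output_mat n C) *\<^sub>v ?x \<in> node_space n S"
        using fr x by (auto simp: friend_def)
      ultimately show "col ?M k \<in> node_space n S"
        using node_space_diff[OF S rest[OF x]] by metis
    qed
  next
    assume cols: "\<forall>k<card C. col ?M k \<in> node_space n S"
    have "(A - H * output_mat n C) *\<^sub>v x \<in> node_space n S" if x: "x \<in> node_space n S" for x
    proof -
      have xc: "x \<in> carrier_vec n" using x node_space_iff[OF S] by blast
      have "?M *\<^sub>v (transpose_mat ?B *\<^sub>v x) \<in> node_space n S"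
        using B xc by (intro mult_in_node_space_of_cols[OF S M cols]) auto
      then show ?thesis unfolding split[OF xc] using node_space_diff[OF S rest[OF x]] by blast
    qed
    then show "friend n C A S H" using H by (auto simp: friend_def)
  qed
qed

theorem theorem10:
  fixes n :: nat and \<E> :: "(nat \<times> nat) set" and A :: "real mat"
    and \<B> \<C> \<D> \<T> :: "nat set"
  assumes edges: "\<E> \<subseteq> {..<n} \<times> {..<n}"
    and A: "A \<in> carrier_mat n n"
    and A_edges: "\<And>i j. i < n \<Longrightarrow> j < n \<Longrightarrow> A $$ (j, i) \<noteq> 0 \<longleftrightarrow> (i, j) \<in> \<E>"
    and nodes: "\<B> \<subseteq> {..<n}" "\<C> \<subseteq> {..<n}" "\<D> \<subseteq> {..<n}" "\<T> \<subseteq> {..<n}"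
    and disjoint: "\<D> \<inter> \<T> = {}" "\<D> \<inter> \<B> = {}" "\<T> \<inter> \<C> = {}"
    and boundary: "\<C> = in_boundary n \<E> (min_inv \<E> \<D> \<C>)"
  defines "\<S> \<equiv> min_inv \<E> \<D> \<C>"
  defines "C \<equiv> output_mat n \<C>"
  defines "S \<equiv> basis_mat n \<S>"
  shows "{H. friend n \<C> A \<S> H} =
    {A * transpose_mat C + S * N | N. N \<in> carrier_mat (card \<S>) (card \<C>)}"
proof -
  have Sn: "\<S> \<subseteq> {..<n}" unfolding \<S>_def by (rule min_inv_subset[OF nodes(3) edges])
  have inv: "CA_invariant n \<C> A \<S>"
    unfolding \<S>_def by (rule min_inv_least(2)[OF A edges A_edges nodes(3)])
  have CS: "\<C> \<subseteq> \<S>" using boundary unfolding \<S>_def in_boundary_def by blast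
  have Ct: "transpose_mat C = basis_mat n \<C>"
    unfolding C_def by (simp add: output_mat_eq_transpose)
  have AC: "A * basis_mat n \<C> \<in> carrier_mat n (card \<C>)"
    by (rule mult_carrier_mat[OF A basis_mat_carrier])
  have SN: "S * N \<in> carrier_mat n (card \<C>)" if "N \<in> carrier_mat (card \<S>) (card \<C>)" for N
    using that unfolding S_def by (metis basis_mat_carrier mult_carrier_mat)
  have friends: "friend n \<C> A \<S> H \<longleftrightarrow>
      (\<exists>N \<in> carrier_mat (card \<S>) (card \<C>). H - A * basis_mat n \<C> = S * N)"
    if H: "H \<in> carrier_mat n (card \<C>)" for H
    using friend_iff_cols_in_node_space[OF A Sn CS inv H]
      cols_in_node_space_iff[OF Sn minus_carrier_mat[OF AC], of H] unfolding S_def by simp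
  have shift: "H - A * basis_mat n \<C> = S * N \<longleftrightarrow> H = A * basis_mat n \<C> + S * N"
    if "H \<in> carrier_mat n (card \<C>)" "N \<in> carrier_mat (card \<S>) (card \<C>)" for H N
    using mat_diff_eq_iff[OF that(1) AC SN[OF that(2)]] .
  show ?thesis unfolding Ct
  proof (intro Set.set_eqI iffI)
    fix H assume "H \<in> {H. friend n \<C> A \<S> H}"
    then have fr: "friend n \<C> A \<S> H" by simp
    then have "H \<in> carrier_mat n (card \<C>)" by (simp add: friend_def)
    then show "H \<in> {A * basis_mat n \<C> + S * N | N. N \<in> carrier_mat (card \<S>) (card \<C>)}"
      using fr friends shift by blast
  next
    fix H assume "H \<in> {A * basis_mat n \<C> + S * N | N. N \<in> carrier_mat (card \<S>) (card \<C>)}"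
    then obtain N where N: "N \<in> carrier_mat (card \<S>) (card \<C>)" "H = A * basis_mat n \<C> + S * N"
      by blast
    then have "H \<in> carrier_mat n (card \<C>)" using AC SN by simp
    then show "H \<in> {H. friend n \<C> A \<S> H}" using N friends shift by blast
  qed
qed

end
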